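(* Let $D\subseteq E^{(n)}$ be a subalgebra (not necessarily containing the identity), and set $A:=\gamma_1\gamma_2\cdots\gamma_n(D)$. Then $A$ is a subalgebra of $E^{(n)}$ spanned as an $\mathbb{F}$-vector space by elements of the form $v_J$, $J\subseteq[n]$, and $\dim(A)=\dim(D)$. Moreover, if $D$ is commutative then $A$ is commutative, and if $D^2=\{0\}$ then $A^2=\{0\}$.
   Context: $\mathbb{F}$ is a field of characteristic different from $2$ and $n\ge1$. $E^{(n)}$ is the Grassmann algebra: the associative unital $\mathbb{F}$-algebra generated by $v_1,\dots,v_n$ subject to $v_iv_j=-v_jv_i$ for $1\le i,j\le n$. Write $[n]=\{1,\dots,n\}$; for $J=\{i_1<\dots<i_m\}\subseteq[n]$ put $v_J=v_{i_1}\cdots v_{i_m}$ (with $v_\emptyset=1$). The $v_J$ form a basis of $E^{(n)}$, and each $x\in E^{(n)}$ is uniquely $x=\sum_{J\subseteq[n]}x_Jv_J$ with $x_J\in\mathbb{F}$. For $i\in[n]$ let $\pi_i:E^{(n)}\to E^{(n)}$ be the linear projection $\pi_i(x)=\sum_{J\subseteq[n],\ i\notin J}x_Jv_J$. For a subspace $D\subseteq E^{(n)}$ define the subspace $\gamma_i(D):=\ker(\pi_i|_D)\oplus\mathrm{im}(\pi_i|_D)$ of $E^{(n)}$, where $\pi_i|_D:D\to E^{(n)}$ is the restriction. The product $\gamma_1\gamma_2\cdots\gamma_n(D)$ means the composition $\gamma_1(\gamma_2(\cdots\gamma_n(D)\cdots))$. For a subspace $D$, $D^2$ denotes the span of all products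 $cd$ with $c,d\in D$. *)

theory Defs
  imports Complex_Main "HOL-Library.Poly_Mapping"
begin

text \<open>
  The index set [n] is rendered as a finite linearly ordered type \<open>'i\<close>, so n = \<open>CARD('i)\<close> is at
  least 1 and otherwise arbitrary.  The Grassmann algebra is literally the free associative unital
  algebra on the letters \<open>'i\<close> modulo the two-sided ideal generated by the anticommutation relations.
\<close>

text \<open>
  Words over \<open>'i\<close> form the free monoid.  It is written additively because the convolution product of
  \<^typ>\<open>'a \<Rightarrow>\<^sub>0 'b\<close> is defined for an additive monoid of exponents; it is not commutative.
\<close>

datatype 'i word = Word (letters: "'i list")

instantiation word :: (type) monoid_add
begin

definition zero_word :: "'a word" where "0 = Word []"

definition plus_word :: "'a word \<Rightarrow> 'a word \<Rightarrow> 'a word"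
  where "u + w = Word (letters u @ letters w)"

instance
  by standard (simp_all add: zero_word_def plus_word_def)

end

type_synonym ('f, 'i) free_algebra = "'i word \<Rightarrow>\<^sub>0 'f"

definition letter :: "'i \<Rightarrow> ('f::field, 'i) free_algebra"
  where "letter i = Poly_Mapping.single (Word [i]) 1"

inductive_set grassmann_ideal :: "('f::field, 'i) free_algebra set" where
  relation: "letter i * letter j + letter j * letter i \<in> grassmann_ideal"
| add: "p \<in> grassmann_ideal \<Longrightarrow> q \<in> grassmann_ideal \<Longrightarrow> p + q \<in> grassmann_ideal"
| mult_left: "p \<in> grassmann_ideal \<Longrightarrow> a * p \<in> grassmann_ideal"
| mult_right: "p \<in> grassmann_ideal \<Longrightarrow> p * a \<in> grassmann_ideal"

lemma grassmann_ideal_zero: "0 \<in> grassmann_ideal"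
  using grassmann_ideal.mult_left[OF grassmann_ideal.relation, of 0] by simp

lemma grassmann_ideal_uminus: "p \<in> grassmann_ideal \<Longrightarrow> - p \<in> grassmann_ideal"
  using grassmann_ideal.mult_left[of p "-1"] by simp

definition grassmann_rel :: "('f::field, 'i) free_algebra \<Rightarrow> ('f, 'i) free_algebra \<Rightarrow> bool"
  where "grassmann_rel p q \<longleftrightarrow> p - q \<in> grassmann_ideal"

lemma grassmann_rel_equivp: "equivp grassmann_rel"
proof (rule equivpI)
  show "reflp grassmann_rel"
    by (simp add: reflp_def grassmann_rel_def grassmann_ideal_zero)
  show "symp grassmann_rel"
    unfolding symp_def grassmann_rel_def by (metis grassmann_ideal_uminus minus_diff_eq)
  show "transp grassmann_rel"
    unfolding transp_def grassmann_rel_def using grassmann_ideal.add by fastforce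
qed

lemma grassmann_rel_refl [simp]: "grassmann_rel p p"
  by (simp add: grassmann_rel_def grassmann_ideal_zero)

quotient_type (overloaded) ('f, 'i) grassmann = "('f::field, 'i) free_algebra" / grassmann_rel
  by (rule grassmann_rel_equivp)

text \<open>Every element of the ideal has vanishing constant term; hence the quotient is nontrivial.\<close>

lemma word_add_eq_0_iff: "u + w = (0 :: 'i word) \<longleftrightarrow> u = 0 \<and> w = 0"
  by (cases u; cases w) (auto simp: zero_word_def plus_word_def)

lemma lookup_mult_0:
  fixes p q :: "('f::field, 'i) free_algebra"
  shows "Poly_Mapping.lookup (p * q) 0 = Poly_Mapping.lookup p 0 * Poly_Mapping.lookup q 0"
proof -
  let ?p = "Poly_Mapping.lookup p" and ?q = "Poly_Mapping.lookup q"
  have *: "(\<lambda>w. ?q w when 0 = u + w) = (\<lambda>w. (?q 0 when u = 0) when w = 0)" for u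
    by (rule ext) (auto simp: when_def word_add_eq_0_iff eq_commute[of 0])
  have "Poly_Mapping.lookup (p * q) 0 = Sum_any (\<lambda>u. ?p u * (?q 0 when u = 0))"
    unfolding lookup_mult * by simp
  also have "\<dots> = Sum_any (\<lambda>u :: 'i word. ?p 0 * ?q 0 when u = 0)"
    by (rule Sum_any.cong) (auto simp: when_def)
  finally show ?thesis
    by simp
qed

lemma lookup_grassmann_ideal_0:
  fixes p :: "('f::field, 'i) free_algebra"
  shows "p \<in> grassmann_ideal \<Longrightarrow> Poly_Mapping.lookup p 0 = 0"
proof (induction rule: grassmann_ideal.induct)
  case (relation i j)
  have "Poly_Mapping.lookup (letter k :: ('f, 'i) free_algebra) 0 = 0" for k
    by (simp add: letter_def lookup_single zero_word_def)
  then show ?case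
    by (simp add: lookup_add lookup_mult_0)
qed (simp_all add: lookup_add lookup_mult_0)

instantiation grassmann :: (field, type) ring_1
begin

lift_definition zero_grassmann :: "('a, 'b) grassmann" is 0 .

lift_definition one_grassmann :: "('a, 'b) grassmann" is 1 .

lift_definition plus_grassmann ::
    "('a, 'b) grassmann \<Rightarrow> ('a, 'b) grassmann \<Rightarrow> ('a, 'b) grassmann" is "(+)"
  unfolding grassmann_rel_def add_diff_add by (rule grassmann_ideal.add)

lift_definition uminus_grassmann :: "('a, 'b) grassmann \<Rightarrow> ('a, 'b) grassmann" is uminus
  unfolding grassmann_rel_def minus_diff_minus by (rule grassmann_ideal_uminus)

lift_definition minus_grassmann ::
    "('a, 'b) grassmann \<Rightarrow> ('a, 'b) grassmann \<Rightarrow> ('a, 'b) grassmann" is "(-)"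
proof -
  fix p p' q q' :: "('a, 'b) free_algebra"
  assume "grassmann_rel p p'" and "grassmann_rel q q'"
  then have "(p - p') + - (q - q') \<in> grassmann_ideal"
    unfolding grassmann_rel_def by (intro grassmann_ideal.add grassmann_ideal_uminus)
  also have "(p - p') + - (q - q') = (p - q) - (p' - q')"
    by simp
  finally show "grassmann_rel (p - q) (p' - q')"
    by (simp add: grassmann_rel_def)
qed

lift_definition times_grassmann ::
    "('a, 'b) grassmann \<Rightarrow> ('a, 'b) grassmann \<Rightarrow> ('a, 'b) grassmann" is "(*)"
proof -
  fix p p' q q' :: "('a, 'b) free_algebra"
  assume "grassmann_rel p p'" and "grassmann_rel q q'"
  then have "p * (q - q') + (p - p') * q' \<in> grassmann_ideal"
    unfolding grassmann_rel_def
    by (intro grassmann_ideal.add grassmann_ideal.mult_left grassmann_ideal.mult_right)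
  also have "p * (q - q') + (p - p') * q' = p * q - p' * q'"
    by (simp add: algebra_simps)
  finally show "grassmann_rel (p * q) (p' * q')"
    by (simp add: grassmann_rel_def)
qed

instance
proof
  show "(0 :: ('a, 'b) grassmann) \<noteq> 1"
    by transfer (auto simp: grassmann_rel_def dest!: lookup_grassmann_ideal_0 simp: lookup_minus)
qed (transfer; simp add: algebra_simps)+

end

lift_definition gscale :: "'f::field \<Rightarrow> ('f, 'i) grassmann \<Rightarrow> ('f, 'i) grassmann"
  is "\<lambda>c p. Poly_Mapping.single 0 c * p"
  unfolding grassmann_rel_def right_diff_distrib[symmetric] by (rule grassmann_ideal.mult_left)

global_interpretation gr: vector_space "gscale :: 'f::field \<Rightarrow> ('f, 'i) grassmann \<Rightarrow> _"
  defines gr_span = gr.span and gr_subspace = gr.subspace and gr_dim = gr.dim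
  by standard
    (transfer; simp add: distrib_left distrib_right single_add mult_single flip: mult.assoc)+

lift_definition gen :: "'i \<Rightarrow> ('f::field, 'i) grassmann" is letter .

lemma gen_anticommute: "gen i * gen j = - (gen j * gen i)"
  by transfer (simp add: grassmann_rel_def grassmann_ideal.relation)

lemma single_0_central:
  fixes p :: "('f::field, 'i) free_algebra"
  shows "p * Poly_Mapping.single 0 c = Poly_Mapping.single 0 c * p"
proof (induction p rule: Poly_Mapping.update_induct)
  case (update p w b)
  have "Poly_Mapping.update w b p = p + Poly_Mapping.single w b"
    using update.hyps(1)
    by (intro poly_mapping_eqI) (auto simp: lookup_update lookup_add lookup_single in_keys_iff)
  then show ?case
    using update.IH by (simp add: distrib_left distrib_right mult_single mult.commute)
qed simp

lemma gscale_mult_left: "gscale c (x * y) = gscale c x * y"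
  by transfer (simp add: mult.assoc)

lemma gscale_mult_right: "gscale c (x * y) = x * gscale c y"
  by transfer (simp add: single_0_central flip: mult.assoc)

definition vmon :: "'i::{finite,linorder} set \<Rightarrow> ('f::field, 'i) grassmann"
  where "vmon J = prod_list (map gen (sorted_list_of_set J))"

text \<open>
  The coordinates of \<open>x\<close> with respect to the elements \<open>vmon J\<close>, which form a basis if the
  characteristic of the field is not 2 (otherwise the squares of the generators do not vanish,
  and coordinates need not exist).
\<close>

definition coords :: "('f::field, 'i::{finite,linorder}) grassmann \<Rightarrow> 'i set \<Rightarrow> 'f"
  where "coords x = (THE c. x = (\<Sum>J\<in>UNIV. gscale (c J) (vmon J)))"

definition proj :: "'i \<Rightarrow> ('f::field, 'i::{finite,linorder}) grassmann \<Rightarrow> ('f, 'i) grassmann"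
  where "proj i x = (\<Sum>J | i \<notin> J. gscale (coords x J) (vmon J))"

text \<open>
  The sum of kernel and image is automatically direct, \<open>proj i\<close> being idempotent.
\<close>

definition gamma ::
    "'i \<Rightarrow> ('f::field, 'i::{finite,linorder}) grassmann set \<Rightarrow> ('f, 'i) grassmann set"
  where "gamma i D = {k + m |k m. k \<in> {x \<in> D. proj i x = 0} \<and> m \<in> proj i ` D}"

text \<open>The largest index is applied first: the composition is \<open>\<gamma>\<^sub>1 (\<gamma>\<^sub>2 (\<dots> (\<gamma>\<^sub>n D)))\<close>.\<close>

definition gamma_all ::
    "('f::field, 'i::{finite,linorder}) grassmann set \<Rightarrow> ('f, 'i) grassmann set"
  where "gamma_all D = foldr gamma (sorted_list_of_set UNIV) D"

definition nonunital_subalgebra :: "('f::field, 'i) grassmann set \<Rightarrow> bool"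
  where "nonunital_subalgebra D \<longleftrightarrow> gr_subspace D \<and> (\<forall>c\<in>D. \<forall>d\<in>D. c * d \<in> D)"

definition commutative_on :: "('f::field, 'i) grassmann set \<Rightarrow> bool"
  where "commutative_on D \<longleftrightarrow> (\<forall>c\<in>D. \<forall>d\<in>D. c * d = d * c)"

definition square_space :: "('f::field, 'i) grassmann set \<Rightarrow> ('f, 'i) grassmann set"
  where "square_space D = gr_span {c * d |c d. c \<in> D \<and> d \<in> D}"

end

theory Submission
  imports Defs
begin

text \<open>
  The projection \<open>\<pi>\<^sub>i\<close> is the algebra endomorphism of the Grassmann algebra that sends the
  generator \<open>v\<^sub>i\<close> to 0 and fixes the other generators, and its kernel is the ideal generated by
  \<open>v\<^sub>i\<close>, in which all products vanish (\<open>proj_mult\<close>, \<open>proj_residue_mult\<close>).  Hence an element \<open>k\<close> of the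
  kernel does not notice whether it is multiplied by \<open>d\<close> or by \<open>\<pi>\<^sub>i d\<close>, and
  for \<open>k\<close>, \<open>l\<close> in the kernel
  \<open>(k + \<pi>\<^sub>i d) (l + \<pi>\<^sub>i e) = (k e + d l) + \<pi>\<^sub>i (d e)\<close>.
  This identity (\<open>gamma_product\<close>) is the heart of the matter: if \<open>k, l, d, e\<close> lie in a subalgebra
  \<open>D\<close>, its right-hand side is again of the form kernel plus image, so \<open>\<gamma>\<^sub>i D\<close> is a subalgebra; if \<open>D\<close> is
  commutative, or has zero multiplication, the right-hand side shows the same for \<open>\<gamma>\<^sub>i D\<close>.
  The dimension is preserved by the rank-nullity theorem.

  The space \<open>\<gamma>\<^sub>i D\<close> is mapped into itself by \<open>\<pi>\<^sub>i\<close>.  Because the projections commute, a later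
  \<open>\<gamma>\<^sub>j\<close> does not destroy this invariance, so \<open>A\<close> is invariant under all projections.
  Composing \<open>\<pi>\<^sub>i\<close> for \<open>i \<notin> J\<close> with \<open>1 - \<pi>\<^sub>i\<close> for \<open>i \<in> J\<close> isolates the component of an element along
  \<open>v\<^sub>J\<close>; therefore \<open>A\<close> contains all monomial components of its elements and is spanned by the
  monomials that it contains (\<open>span_vmon_if_proj_invariant\<close>).

  All of this presupposes that the \<open>v\<^sub>J\<close> form a basis.  They span because any word in the generators
  can be sorted up to sign and vanishes when a letter repeats, which is where characteristic different
  from 2 enters.  They are independent because the free algebra acts on the
  functions on the subsets of \<open>[n]\<close> by operators that satisfy the anticommutation
  relations, and \<open>v\<^sub>J\<close> sends the indicator function of \<open>\<emptyset>\<close> to that of \<open>J\<close>.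
\<close>

section \<open>Dimension of kernel plus image\<close>

lemma (in vector_space) dim_image_inj_on_subspace:
  assumes g: "Vector_Spaces.linear scale scale g" and V: "subspace V" and inj: "inj_on g V"
  shows "dim (g ` V) = dim V"
proof -
  interpret vp: vector_space_pair scale scale ..
  obtain B where B: "B \<subseteq> V" "independent B" "V \<subseteq> span B" "card B = dim V"
    using basis_exists by blast
  have span: "span B = V"
    using B V by (metis span_subspace)
  have "independent (g ` B)"
    using g B(2) inj span by (metis vp.linear_independent_injective_image)
  moreover have "span (g ` B) = g ` V"
    using vp.linear_span_image[OF g, of B] span by simp
  ultimately have "dim (g ` V) = card (g ` B)"
    by (metis dim_span_eq_card_independent)
  also have "\<dots> = card B"
    using inj B(1) by (meson card_image inj_on_subset)
  finally show ?thesis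
    using B(4) by simp
qed

text \<open>
  With \<open>p\<close> a linear projection onto the kernel
  \<open>K\<close> of \<open>f\<close> on \<open>D\<close>, the linear map \<open>f + p\<close> carries \<open>D\<close> isomorphically onto the sum of kernel and image:
  applying \<open>f\<close> to \<open>f x + p x = 0\<close> gives \<open>f x = 0\<close>, whence \<open>x\<close> lies in \<open>K\<close> and \<open>x = p x = 0\<close>.
\<close>

lemma (in vector_space) dim_kernel_plus_image:
  assumes f: "Vector_Spaces.linear scale scale f" and idem: "\<And>x. f (f x) = f x" and D: "subspace D"
  shows "dim {k + m |k m. k \<in> {x \<in> D. f x = 0} \<and> m \<in> f ` D} = dim D"
proof -
  interpret vp: vector_space_pair scale scale ..
  interpret f: Vector_Spaces.linear scale scale f by fact
  define K where "K = {x \<in> D. f x = 0}"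
  have "subspace K"
    using D by (auto simp: K_def subspace_def f.add f.scale f.zero)
  then obtain p where p: "range p \<subseteq> K" "Vector_Spaces.linear scale scale p" "\<And>v. v \<in> K \<Longrightarrow> p v = v"
    using vp.linear_exists_left_inverse_on[OF linear_id, of K] by auto
  interpret p: Vector_Spaces.linear scale scale p by fact
  have pK: "p x \<in> K" for x
    using p(1) by auto
  have fp: "f (p x) = 0" for x
    using pK[of x] by (simp add: K_def)
  define g where "g x = f x + p x" for x
  have g: "Vector_Spaces.linear scale scale g"
    unfolding g_def by (intro vp.linear_compose_add f p(2))
  interpret g: Vector_Spaces.linear scale scale g by fact
  have "x = 0" if "x \<in> D" "g x = 0" for x
  proof -
    have "f (g x) = f x"
      by (simp add: g_def f.add idem fp)
    then have "f x = 0"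
      using that(2) by (simp add: f.zero)
    with that p(3)[of x] show "x = 0"
      by (simp add: K_def g_def)
  qed
  then have inj: "inj_on g D"
    using g.inj_on_iff_eq_0[OF D] by blast
  have "{k + m |k m. k \<in> K \<and> m \<in> f ` D} = g ` D"
  proof safe
    fix k d assume k: "k \<in> K" and d: "d \<in> D"
    \<comment> \<open>Replacing the \<open>K\<close>-part \<open>p d\<close> of \<open>d\<close> by \<open>k\<close> leaves \<open>f d\<close> unchanged.\<close>
    let ?x = "k - p d + d"
    have "?x \<in> D"
      using k d pK[of d] D by (auto simp: K_def subspace_add subspace_diff)
    moreover have "g ?x = k + f d"
      using k p(3)[OF k] p(3)[OF pK[of d]]
      by (simp add: g_def f.add f.diff p.add p.diff fp K_def)
    ultimately show "k + f d \<in> g ` D"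
      by (metis image_eqI)
  next
    fix d assume "d \<in> D"
    then show "\<exists>k m. g d = k + m \<and> k \<in> K \<and> m \<in> f ` D"
      using pK[of d] by (metis g_def add.commute image_eqI)
  qed
  then show ?thesis
    using dim_image_inj_on_subspace[OF g D inj] by (simp add: K_def)
qed

section \<open>Membership in gamma and vanishing squares\<close>

lemma gamma_cases:
  assumes "x \<in> gamma i D"
  obtains k d where "x = k + proj i d" "k \<in> D" "proj i k = 0" "d \<in> D"
  using assms unfolding gamma_def by blast

lemma gammaI: "k \<in> D \<Longrightarrow> proj i k = 0 \<Longrightarrow> d \<in> D \<Longrightarrow> k + proj i d \<in> gamma i D"
  unfolding gamma_def by blast

lemma square_space_eq_0_iff: "square_space D = {0} \<longleftrightarrow> (\<forall>c\<in>D. \<forall>d\<in>D. c * d = 0)"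
proof
  assume *: "square_space D = {0}"
  show "\<forall>c\<in>D. \<forall>d\<in>D. c * d = 0"
  proof (intro ballI)
    fix c d
    assume "c \<in> D" "d \<in> D"
    then have "c * d \<in> square_space D"
      unfolding square_space_def by (intro gr.span_base) auto
    with * show "c * d = 0"
      by simp
  qed
next
  assume *: "\<forall>c\<in>D. \<forall>d\<in>D. c * d = 0"
  have "square_space D \<subseteq> {0}"
    unfolding square_space_def using * by (intro gr.span_minimal) auto
  moreover have "0 \<in> square_space D"
    unfolding square_space_def by (rule gr.span_zero)
  ultimately show "square_space D = {0}"
    by blast
qed

section \<open>Coordinates\<close>

lemma poly_mapping_single_induct [case_names single add]:
  fixes p :: "'a \<Rightarrow>\<^sub>0 'b::monoid_add"
  assumes "\<And>w c. P (Poly_Mapping.single w c)" and "\<And>p q. P p \<Longrightarrow> P q \<Longrightarrow> P (p + q)"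
  shows "P p"
proof (induction p rule: Poly_Mapping.update_induct)
  case const
  show ?case
    using assms(1)[of undefined 0] by simp
next
  case (update p w b)
  have "Poly_Mapping.update w b p = p + Poly_Mapping.single w b"
    using update.hyps(1)
    by (intro poly_mapping_eqI) (auto simp: lookup_update lookup_add lookup_single in_keys_iff)
  with update.IH assms show ?case
    by metis
qed

text \<open>
  Left multiplication by \<open>v\<^sub>i\<close> in the coordinates of the expected basis: \<open>v\<^sub>i v\<^bsub>J - {i}\<^esub>\<close> is \<open>v\<^sub>J\<close> up to
  the sign that counts the letters of \<open>J\<close> which \<open>v\<^sub>i\<close> has to pass.
\<close>

definition left_op :: "'i::{finite,linorder} \<Rightarrow> ('i set \<Rightarrow> 'f::field) \<Rightarrow> 'i set \<Rightarrow> 'f"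
  where "left_op i f J = (if i \<in> J then (-1) ^ card {j \<in> J. j < i} * f (J - {i}) else 0)"

text \<open>
  Of the two orders of insertion, \<open>j\<close> passes \<open>i\<close> in exactly one, while \<open>i\<close> never passes \<open>j\<close>; so the
  signs differ.
\<close>

lemma left_op_anticommute_less:
  assumes "i < j"
  shows "left_op i (left_op j f) J = - left_op j (left_op i f) J"
proof (cases "i \<in> J \<and> j \<in> J")
  case True
  have "{l \<in> J. l < j} = insert i {l \<in> J - {i}. l < j}"
    using assms True by auto
  then have 1: "card {l \<in> J. l < j} = Suc (card {l \<in> J - {i}. l < j})"
    by simp
  have 2: "{l \<in> J - {j}. l < i} = {l \<in> J. l < i}"
    using assms by auto
  have 3: "J - {i} - {j} = J - {j} - {i}"
    by auto
  show ?thesis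
    using True assms unfolding left_op_def 1 2 3 by simp
qed (auto simp: left_op_def)

lemma left_op_anticommute: "left_op i (left_op j f) J + left_op j (left_op i f) J = 0"
proof (cases i j rule: linorder_cases)
  case less
  then show ?thesis
    by (simp add: left_op_anticommute_less[of i j])
next
  case greater
  then show ?thesis
    by (simp add: left_op_anticommute_less[of j i])
qed (simp add: left_op_def)

text \<open>
  The extension of the operators \<open>left_op i\<close> to a representation of the free algebra.
\<close>

definition act ::
    "('f::field, 'i::{finite,linorder}) free_algebra \<Rightarrow> ('i set \<Rightarrow> 'f) \<Rightarrow> 'i set \<Rightarrow> 'f"
  where "act p f J =
    (\<Sum>w\<in>Poly_Mapping.keys p. Poly_Mapping.lookup p w * foldr left_op (letters w) f J)"

lemma act_superset:
  assumes "finite W" "Poly_Mapping.keys p \<subseteq> W"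
  shows "act p f J = (\<Sum>w\<in>W. Poly_Mapping.lookup p w * foldr left_op (letters w) f J)"
  unfolding act_def using assms by (intro sum.mono_neutral_left) (auto simp: in_keys_iff)

lemma act_single: "act (Poly_Mapping.single w c) f J = c * foldr left_op (letters w) f J"
  by (subst act_superset[of "{w}"]) auto

lemma act_add: "act (p + q) f J = act p f J + act q f J"
  using keys_add[of p q]
  by (subst (1 2 3) act_superset[of "Poly_Mapping.keys p \<union> Poly_Mapping.keys q"])
    (auto simp: lookup_add algebra_simps sum.distrib)

lemma foldr_left_op_lin:
  "foldr left_op xs (\<lambda>J. f J + c * g J) = (\<lambda>J. foldr left_op xs f J + c * foldr left_op xs g J)"
  by (induction xs) (auto simp: left_op_def fun_eq_iff algebra_simps)

lemma foldr_left_op_scale: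
  "foldr left_op xs (\<lambda>J. c * f J) = (\<lambda>J. c * foldr left_op xs f J)"
  by (induction xs) (auto simp: left_op_def fun_eq_iff)

lemma act_lin: "act p (\<lambda>J. f J + c * g J) J = act p f J + c * act p g J"
  by (simp add: act_def foldr_left_op_lin algebra_simps sum.distrib sum_distrib_left)

lemma act_mult: "act (p * q) f = act p (act q f)"
proof (induction p rule: poly_mapping_single_induct)
  case (single u a)
  show ?case
  proof (induction q rule: poly_mapping_single_induct)
    case (single w b)
    show ?case
      by (simp add: fun_eq_iff mult_single act_single[abs_def] foldr_left_op_scale plus_word_def)
  next
    case (add p q)
    have "act (p + q) f = (\<lambda>J. act p f J + act q f J)"
      by (simp add: fun_eq_iff act_add)
    with add show ?case
      using act_lin[of _ "act p f" 1 "act q f"] by (simp add: fun_eq_iff distrib_left act_add)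
  qed
next
  case (add p q)
  then show ?case
    by (simp add: distrib_right act_add fun_eq_iff)
qed

lemma act_grassmann_ideal: "p \<in> grassmann_ideal \<Longrightarrow> act p f = (\<lambda>J. 0)"
proof (induction arbitrary: f rule: grassmann_ideal.induct)
  case (relation i j)
  show ?case
    by (simp add: fun_eq_iff act_add act_mult letter_def act_single[abs_def] left_op_anticommute)
next
  case (mult_left p a)
  have "act (a * p) f = act a (\<lambda>J. 0)"
    by (simp add: act_mult mult_left.IH)
  then show ?case
    using act_lin[of a "\<lambda>_. 0" "-1" "\<lambda>_. 0"] by (simp add: fun_eq_iff)
qed (simp_all add: act_add act_mult fun_eq_iff)

text \<open>
  Since the representation annihilates the ideal, applying it to the indicator function of the empty
  set, which stands for the unit, is well defined on the quotient and reads off coordinates.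
\<close>

lift_definition gcoeff :: "('f::field, 'i::{finite,linorder}) grassmann \<Rightarrow> 'i set \<Rightarrow> 'f"
  is "\<lambda>p. act p (\<lambda>J. of_bool (J = {}))"
proof -
  fix p q :: "('f, 'i) free_algebra"
  assume "grassmann_rel p q"
  then have "act (p - q) f J = 0" for f J
    by (simp add: grassmann_rel_def act_grassmann_ideal)
  then have "act p f J = act q f J" for f J
    using act_add[of "p - q" q f J] by simp
  then show "act p (\<lambda>J. of_bool (J = {})) = act q (\<lambda>J. of_bool (J = {}))"
    by (simp add: fun_eq_iff)
qed

lemma gcoeff_add [simp]: "gcoeff (x + y) J = gcoeff x J + gcoeff y J"
  by transfer (rule act_add)

lemma gcoeff_scale [simp]: "gcoeff (gscale c x) J = c * gcoeff x J"
  by transfer (simp add: act_mult act_single zero_word_def)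

lemma gcoeff_0 [simp]: "gcoeff 0 J = 0"
  by transfer (simp add: act_def)

lemma gcoeff_diff [simp]: "gcoeff (x - y) J = gcoeff x J - gcoeff y J"
  using gcoeff_add[of "x - y" y J] by simp

lemma gcoeff_sum [simp]: "gcoeff (sum h I) J = (\<Sum>i\<in>I. gcoeff (h i) J)"
  by (induction I rule: infinite_finite_induct) auto

lemma gcoeff_1: "gcoeff 1 J = of_bool (J = {})"
  by transfer (simp add: act_single zero_word_def flip: single_one)

lemma gcoeff_gen_mult: "gcoeff (gen i * x) = left_op i (gcoeff x)"
  by transfer (simp add: act_mult letter_def act_single fun_eq_iff)

text \<open>
  Multiplying by the letters of an increasing word from right to left always inserts a new
  minimum, so no sign appears.
\<close>

lemma gcoeff_strict_sorted:
  "sorted_wrt (<) xs \<Longrightarrow> gcoeff (prod_list (map gen xs)) K = of_bool (K = set xs)"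
proof (induction xs arbitrary: K)
  case (Cons x xs)
  have x: "x \<notin> set xs" "{j. (j = x \<or> j \<in> set xs) \<and> j < x} = {}"
    using Cons.prems by auto
  show ?case
  proof (cases "K = insert x (set xs)")
    case True
    with Cons show ?thesis
      by (simp add: gcoeff_gen_mult left_op_def x)
  next
    case False
    with x have "x \<in> K \<Longrightarrow> K - {x} \<noteq> set xs"
      by auto
    with False Cons show ?thesis
      by (simp add: gcoeff_gen_mult left_op_def)
  qed
qed (simp add: gcoeff_1)

lemma gcoeff_vmon [simp]: "gcoeff (vmon J) K = of_bool (K = J)"
  by (simp add: vmon_def gcoeff_strict_sorted)

section \<open>Products of monomials\<close>

lemma gen_mult_left_commute: "gen i * (gen j * x) = - (gen j * (gen i * x))"
  by (simp add: gen_anticommute[of i j] flip: mult.assoc)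

lemma gen_mult_word:
  "\<exists>c. gen i * prod_list (map gen xs) =
    gscale c (prod_list (map gen (insort i xs)) :: ('f::field, 'i::linorder) grassmann)"
proof (induction xs)
  case Nil
  show ?case
    by (auto intro: exI[of _ 1])
next
  case (Cons x xs)
  show ?case
  proof (cases "i \<le> x")
    case True
    then show ?thesis
      by (auto intro: exI[of _ 1])
  next
    case False
    obtain c where c: "gen i * prod_list (map gen xs) =
        gscale c (prod_list (map gen (insort i xs)) :: ('f, 'i) grassmann)"
      using Cons.IH ..
    have "gen i * (gen x * prod_list (map gen xs)) =
        - (gen x * (gen i * prod_list (map gen xs)) :: ('f, 'i) grassmann)"
      by (rule gen_mult_left_commute)
    also have "\<dots> = gscale (- c) (gen x * prod_list (map gen (insort i xs)))"
      unfolding c by (simp add: gscale_mult_right)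
    finally show ?thesis
      using False by (intro exI[of _ "- c"]) simp
  qed
qed

context
  assumes char: "CHAR('f::field) \<noteq> 2"
begin

lemma two_nonzero: "(2 :: 'f) \<noteq> 0"
proof
  assume "(2 :: 'f) = 0"
  then have "CHAR('f) dvd 2"
    using of_nat_eq_0_iff_char_dvd[where 'a = 'f, of 2] by simp
  then have "CHAR('f) = 1"
    using char dvd_imp_le[of "CHAR('f)" 2] by (cases "CHAR('f) = 0") (simp, linarith)
  then show False
    using of_nat_CHAR[where 'a = 'f] by simp
qed

text \<open>
  The relation for \<open>i = j\<close> only says \<open>2 v\<^sub>i\<^sup>2 = 0\<close>; this is the one place where 2 is divided by.
\<close>

lemma gen_square: "gen i * gen i = (0 :: ('f, 'i) grassmann)"
proof -
  let ?x = "gen i * gen i :: ('f, 'i) grassmann"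
  have "?x + ?x = 0"
    using gen_anticommute[of i i, where ?'a = 'f] by (metis add.right_inverse)
  then have "gscale 2 ?x = 0"
    using gr.scale_left_distrib[of 1 1 ?x] by simp
  then show ?thesis
    using two_nonzero by simp
qed

lemma gen_mult_word_0:
  "i \<in> set xs \<Longrightarrow> gen i * prod_list (map gen xs) = (0 :: ('f, 'i) grassmann)"
proof (induction xs)
  case (Cons x xs)
  show ?case
  proof (cases "i = x")
    case True
    then show ?thesis
      by (simp add: gen_square flip: mult.assoc)
  next
    case False
    with Cons show ?thesis
      by (simp add: gen_mult_left_commute[of i x])
  qed
qed simp

lemma gen_mult_vmon_0: "i \<in> J \<Longrightarrow> gen i * vmon J = (0 :: ('f, 'i::{finite,linorder}) grassmann)"
  by (simp add: vmon_def gen_mult_word_0)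

lemma gen_mult_vmon:
  "\<exists>c. gen i * vmon J = gscale c (vmon (insert i J) :: ('f, 'i::{finite,linorder}) grassmann)"
proof (cases "i \<in> J")
  case True
  then show ?thesis
    by (auto simp: gen_mult_vmon_0 intro: exI[of _ 0])
next
  case False
  then show ?thesis
    using gen_mult_word[of i "sorted_list_of_set J"] by (simp add: vmon_def)
qed

lemma word_mult_vmon:
  "\<exists>c. prod_list (map gen xs) * vmon K =
    gscale c (vmon (set xs \<union> K) :: ('f, 'i::{finite,linorder}) grassmann)"
proof (induction xs)
  case Nil
  show ?case
    by (auto intro: exI[of _ 1])
next
  case (Cons x xs)
  then obtain c where c: "prod_list (map gen xs) * vmon K =
      gscale c (vmon (set xs \<union> K) :: ('f, 'i) grassmann)"
    by blast
  obtain d where "gen x * vmon (set xs \<union> K) =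
      gscale d (vmon (insert x (set xs \<union> K)) :: ('f, 'i) grassmann)"
    using gen_mult_vmon by blast
  then have "prod_list (map gen (x # xs)) * vmon K =
      gscale (c * d) (vmon (set (x # xs) \<union> K) :: ('f, 'i) grassmann)"
    using c by (simp add: mult.assoc flip: gscale_mult_right)
  then show ?case
    by blast
qed

lemma word_mult_vmon_0:
  "i \<in> set xs \<Longrightarrow> i \<in> K \<Longrightarrow>
    prod_list (map gen xs) * vmon K = (0 :: ('f, 'i::{finite,linorder}) grassmann)"
proof (induction xs)
  case (Cons x xs)
  obtain c where c: "prod_list (map gen xs) * vmon K =
      gscale c (vmon (set xs \<union> K) :: ('f, 'i) grassmann)"
    using word_mult_vmon by blast
  show ?case
  proof (cases "x = i")
    case True
    with Cons c show ?thesis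
      by (simp add: mult.assoc gen_mult_vmon_0 flip: gscale_mult_right)
  next
    case False
    with Cons show ?thesis
      by (simp add: mult.assoc)
  qed
qed simp

lemma vmon_mult_vmon:
  "\<exists>c. vmon J * vmon K = gscale c (vmon (J \<union> K) :: ('f, 'i::{finite,linorder}) grassmann)"
  using word_mult_vmon[of "sorted_list_of_set J" K] by (simp add: vmon_def[of J])

lemma vmon_mult_vmon_0:
  "i \<in> J \<Longrightarrow> i \<in> K \<Longrightarrow> vmon J * vmon K = (0 :: ('f, 'i::{finite,linorder}) grassmann)"
  using word_mult_vmon_0[of i "sorted_list_of_set J" K] by (simp add: vmon_def[of J])

section \<open>The monomial basis\<close>

text \<open>
  The monomials span: the free algebra is spanned by words, and every word is a scalar multiple of
  the monomial on its set of letters.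
\<close>

lemma grassmann_induct [case_names scale add]:
  fixes x :: "('f, 'i::{finite,linorder}) grassmann"
  assumes scale: "\<And>c J. P (gscale c (vmon J))" and add: "\<And>x y. P x \<Longrightarrow> P y \<Longrightarrow> P (x + y)"
  shows "P x"
proof (induction x rule: grassmann.abs_induct)
  case (1 p)
  show ?case
  proof (induction p rule: poly_mapping_single_induct)
    case (single w c)
    have "abs_grassmann (Poly_Mapping.single (Word xs) 1) =
        (prod_list (map gen xs) :: ('f, 'i) grassmann)" for xs
    proof (induction xs)
      case Nil
      show ?case
        by (simp add: one_grassmann_def flip: zero_word_def)
    next
      case (Cons x xs)
      have "Poly_Mapping.single (Word (x # xs)) 1 =
          (letter x * Poly_Mapping.single (Word xs) 1 :: ('f, 'i) free_algebra)"
        by (simp add: letter_def mult_single plus_word_def)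
      then show ?case
        using Cons by (simp add: gen.abs_eq flip: times_grassmann.abs_eq)
    qed
    moreover have "abs_grassmann (Poly_Mapping.single w c) =
        gscale c (abs_grassmann (Poly_Mapping.single w 1) :: ('f, 'i) grassmann)"
      by (simp add: gscale.abs_eq mult_single)
    ultimately have "abs_grassmann (Poly_Mapping.single w c) =
        gscale c (prod_list (map gen (letters w)) :: ('f, 'i) grassmann)"
      by (metis word.collapse)
    moreover obtain d where "prod_list (map gen (letters w)) * vmon {} =
        gscale d (vmon (set (letters w) \<union> {}) :: ('f, 'i) grassmann)"
      using word_mult_vmon by blast
    moreover have "vmon {} = (1 :: ('f, 'i) grassmann)"
      by (simp add: vmon_def)
    ultimately show ?case
      using scale by simp
  next
    case (add p q)
    then show ?case
      using assms(2) by (simp flip: plus_grassmann.abs_eq)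
  qed
qed

text \<open>
  The expansion is linear in \<open>x\<close>, so it is enough that it holds for monomials.
\<close>

lemma vmon_expansion:
  fixes x :: "('f, 'i::{finite,linorder}) grassmann"
  shows "x = (\<Sum>J\<in>UNIV. gscale (gcoeff x J) (vmon J))"
proof (induction x rule: grassmann_induct)
  case (scale c J)
  have "gscale (gcoeff (gscale c (vmon J)) K) (vmon K) =
      (if K = J then gscale c (vmon J) else 0 :: ('f, 'i) grassmann)" for K
    by simp
  then show ?case
    by simp
next
  case (add x y)
  then show ?case
    by (simp add: gr.scale_left_distrib sum.distrib)
qed

lemma gcoeff_eqI:
  fixes x y :: "('f, 'i::{finite,linorder}) grassmann"
  assumes "\<And>J. gcoeff x J = gcoeff y J"
  shows "x = y"
  using vmon_expansion[of x] vmon_expansion[of y] assms by simp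

lemma coords_eq_gcoeff:
  fixes x :: "('f, 'i::{finite,linorder}) grassmann"
  shows "coords x = gcoeff x"
  unfolding coords_def
proof (rule the_equality)
  show "x = (\<Sum>J\<in>UNIV. gscale (gcoeff x J) (vmon J))"
    by (rule vmon_expansion)
  fix c
  assume x: "x = (\<Sum>J\<in>UNIV. gscale (c J) (vmon J))"
  show "c = gcoeff x"
    by (subst x) (auto simp: fun_eq_iff)
qed

section \<open>The projections\<close>

lemma gcoeff_proj [simp]:
  fixes x :: "('f, 'i::{finite,linorder}) grassmann"
  shows "gcoeff (proj i x) J = (if i \<in> J then 0 else gcoeff x J)"
  by (auto simp: proj_def coords_eq_gcoeff)

lemma proj_linear:
  "Vector_Spaces.linear gscale gscale (proj i :: ('f, 'i::{finite,linorder}) grassmann \<Rightarrow> _)"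
  by unfold_locales (auto intro!: gcoeff_eqI simp: algebra_simps)

lemma proj_idem: "proj i (proj i x) = proj i (x :: ('f, 'i::{finite,linorder}) grassmann)"
  by (rule gcoeff_eqI) simp

lemma proj_commute:
  "proj i (proj j x) = proj j (proj i (x :: ('f, 'i::{finite,linorder}) grassmann))"
  by (rule gcoeff_eqI) simp

lemma proj_add: "proj i (x + y) = proj i x + proj i (y :: ('f, 'i::{finite,linorder}) grassmann)"
  by (rule gcoeff_eqI) simp

lemma proj_scale:
  "proj i (gscale c x) = gscale c (proj i (x :: ('f, 'i::{finite,linorder}) grassmann))"
  by (rule gcoeff_eqI) simp

lemma proj_0: "proj i 0 = (0 :: ('f, 'i::{finite,linorder}) grassmann)"
  by (rule gcoeff_eqI) simp

lemma proj_vmon: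
  "proj i (vmon J) = (if i \<in> J then 0 else vmon J :: ('f, 'i::{finite,linorder}) grassmann)"
  by (rule gcoeff_eqI) auto

text \<open>
  For monomials, both sides vanish when \<open>i\<close> belongs to one of the two index sets, that is, to their
  union, and both are the plain product otherwise.
\<close>

lemma proj_mult:
  "proj i (x * y) = proj i x * proj i (y :: ('f, 'i::{finite,linorder}) grassmann)"
proof (induction x rule: grassmann_induct)
  case (scale c J)
  show ?case
  proof (induction y rule: grassmann_induct)
    case (scale d K)
    obtain e where e: "vmon J * vmon K = gscale e (vmon (J \<union> K) :: ('f, 'i) grassmann)"
      using vmon_mult_vmon by blast
    then have "proj i (vmon J * vmon K :: ('f, 'i) grassmann) = proj i (vmon J) * proj i (vmon K)"
      by (auto simp: proj_scale proj_vmon)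
    then show ?case
      by (simp add: proj_scale flip: gscale_mult_left gscale_mult_right)
  qed (simp add: proj_add distrib_left)
qed (simp add: proj_add distrib_right)

text \<open>
  The kernel of a projection consists of the elements \<open>x - proj i x\<close>, which are combinations
  of monomials containing \<open>v\<^sub>i\<close>; a product of two such monomials repeats \<open>v\<^sub>i\<close>.
\<close>

lemma proj_residue_mult:
  "(x - proj i x) * (y - proj i y) = (0 :: ('f, 'i::{finite,linorder}) grassmann)"
proof (induction x rule: grassmann_induct)
  case (scale c J)
  show ?case
  proof (induction y rule: grassmann_induct)
    case (scale d K)
    have "(vmon J - proj i (vmon J)) * (vmon K - proj i (vmon K)) = (0 :: ('f, 'i) grassmann)"
      by (simp add: proj_vmon vmon_mult_vmon_0)
    then show ?case
      by (simp add: proj_scale flip: gscale_mult_left gscale_mult_right gr.scale_right_diff_distrib)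
  qed (simp add: proj_add add_diff_add distrib_left)
qed (simp add: proj_add add_diff_add distrib_right)

lemma kernel_mult:
  fixes k d :: "('f, 'i::{finite,linorder}) grassmann"
  assumes "proj i k = 0"
  shows "k * d = k * proj i d" and "d * k = proj i d * k"
  using proj_residue_mult[of k i d] proj_residue_mult[of d i k] assms
  by (simp_all add: algebra_simps)

section \<open>The operation gamma\<close>

lemma gamma_subspace:
  fixes D :: "('f, 'i::{finite,linorder}) grassmann set"
  assumes "gr_subspace D"
  shows "gr_subspace (gamma i D)"
proof -
  interpret p: Vector_Spaces.linear gscale gscale
    "proj i :: ('f, 'i::{finite,linorder}) grassmann \<Rightarrow> _"
    by (rule proj_linear)
  have "gr_subspace {x \<in> D. proj i x = 0}"
    using assms by (auto simp: gr.subspace_def p.add p.scale p.zero)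
  moreover have "gr_subspace (proj i ` D)"
    using p.subspace_image assms by (simp add: gr_subspace_def)
  ultimately show ?thesis
    unfolding gamma_def by (rule gr.subspace_sums)
qed

text \<open>
  The terms \<open>k (proj i e)\<close> and \<open>(proj i d) l\<close> of the expanded product equal \<open>k e\<close> and \<open>d l\<close>, and
  \<open>k l\<close> vanishes.  On the right every product is formed from \<open>k, l, d, e\<close> themselves, which is what
  transfers multiplicative properties of \<open>D\<close> to \<open>gamma i D\<close>.
\<close>

lemma gamma_product:
  fixes k l d e :: "('f, 'i::{finite,linorder}) grassmann"
  assumes "proj i k = 0" "proj i l = 0"
  shows "(k + proj i d) * (l + proj i e) = (k * e + d * l) + proj i (d * e)"
proof -
  have "k * l = 0"
    using kernel_mult(1)[OF assms(1), of l] assms(2) by simp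
  then show ?thesis
    using kernel_mult(1)[OF assms(1), of e] kernel_mult(2)[OF assms(2), of d]
    by (simp add: algebra_simps proj_mult)
qed

lemma gamma_subalgebra:
  fixes D :: "('f, 'i::{finite,linorder}) grassmann set"
  assumes "nonunital_subalgebra D"
  shows "nonunital_subalgebra (gamma i D)"
  unfolding nonunital_subalgebra_def
proof (intro conjI ballI)
  show "gr_subspace (gamma i D)"
    using assms by (simp add: nonunital_subalgebra_def gamma_subspace)
  fix x y
  assume "x \<in> gamma i D" "y \<in> gamma i D"
  then obtain k d l e where
    x: "x = k + proj i d" "k \<in> D" "proj i k = 0" "d \<in> D" and
    y: "y = l + proj i e" "l \<in> D" "proj i l = 0" "e \<in> D"
    by (elim gamma_cases)
  have "k * e + d * l \<in> D" "d * e \<in> D"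
    using assms x y by (auto simp: nonunital_subalgebra_def gr.subspace_add)
  moreover have "proj i (k * e + d * l) = 0"
    using x y by (simp add: proj_add proj_mult)
  ultimately show "x * y \<in> gamma i D"
    using x y by (simp add: gamma_product gammaI)
qed

lemma gamma_commutative:
  fixes D :: "('f, 'i::{finite,linorder}) grassmann set"
  assumes "commutative_on D"
  shows "commutative_on (gamma i D)"
  using assms unfolding commutative_on_def
  by (auto elim!: gamma_cases simp: gamma_product add.commute)

lemma gamma_square_zero:
  fixes D :: "('f, 'i::{finite,linorder}) grassmann set"
  assumes "\<And>c d. c \<in> D \<Longrightarrow> d \<in> D \<Longrightarrow> c * d = 0"
  shows "x \<in> gamma i D \<Longrightarrow> y \<in> gamma i D \<Longrightarrow> x * y = 0"
  using assms by (auto elim!: gamma_cases simp: gamma_product proj_0)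

lemma gamma_dim:
  fixes D :: "('f, 'i::{finite,linorder}) grassmann set"
  assumes "gr_subspace D"
  shows "gr_dim (gamma i D) = gr_dim D"
  unfolding gamma_def by (rule gr.dim_kernel_plus_image[OF proj_linear proj_idem assms])

text \<open>
  On \<open>k + proj i d\<close> the projection just drops \<open>k\<close>.
\<close>

lemma gamma_proj_self:
  fixes D :: "('f, 'i::{finite,linorder}) grassmann set"
  assumes "gr_subspace D" "x \<in> gamma i D"
  shows "proj i x \<in> gamma i D"
  using assms gammaI[of 0 D i] gr.subspace_0[OF assms(1)]
  by (auto elim!: gamma_cases simp: proj_add proj_idem proj_0)

text \<open>
  By commutation, \<open>proj j\<close> maps the kernel and the image of \<open>proj i\<close> on \<open>D\<close> into themselves as
  soon as it maps \<open>D\<close> into itself.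
\<close>

lemma gamma_proj_other:
  fixes D :: "('f, 'i::{finite,linorder}) grassmann set"
  assumes "\<And>x. x \<in> D \<Longrightarrow> proj j x \<in> D" "x \<in> gamma i D"
  shows "proj j x \<in> gamma i D"
proof -
  obtain k d where x: "x = k + proj i d" "k \<in> D" "proj i k = 0" "d \<in> D"
    using assms(2) by (rule gamma_cases)
  have "proj i (proj j k) = 0"
    using x(3) by (simp add: proj_commute[of i j] proj_0)
  moreover have "proj j x = proj j k + proj i (proj j d)"
    by (simp add: x(1) proj_add proj_commute[of i j])
  ultimately show ?thesis
    using x assms(1) by (simp add: gammaI)
qed

section \<open>Iterating gamma\<close>

lemma foldr_gamma_subalgebra:
  fixes D :: "('f, 'i::{finite,linorder}) grassmann set"
  assumes "nonunital_subalgebra D"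
  shows "nonunital_subalgebra (foldr gamma xs D)"
  using assms by (induction xs) (auto intro: gamma_subalgebra)

lemma foldr_gamma_subspace:
  fixes D :: "('f, 'i::{finite,linorder}) grassmann set"
  assumes "gr_subspace D"
  shows "gr_subspace (foldr gamma xs D)"
  using assms by (induction xs) (auto intro: gamma_subspace)

lemma foldr_gamma_dim:
  fixes D :: "('f, 'i::{finite,linorder}) grassmann set"
  assumes "gr_subspace D"
  shows "gr_dim (foldr gamma xs D) = gr_dim D"
  using assms by (induction xs) (auto simp: gamma_dim foldr_gamma_subspace)

lemma foldr_gamma_commutative:
  fixes D :: "('f, 'i::{finite,linorder}) grassmann set"
  assumes "commutative_on D"
  shows "commutative_on (foldr gamma xs D)"
  using assms by (induction xs) (auto intro: gamma_commutative)

lemma foldr_gamma_square_zero: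
  fixes D :: "('f, 'i::{finite,linorder}) grassmann set"
  assumes "\<And>c d. c \<in> D \<Longrightarrow> d \<in> D \<Longrightarrow> c * d = 0"
  shows "x \<in> foldr gamma xs D \<Longrightarrow> y \<in> foldr gamma xs D \<Longrightarrow> x * y = 0"
proof (induction xs arbitrary: x y)
  case (Cons j js)
  then show ?case
    using gamma_square_zero[of "foldr gamma js D" x j y] by simp
qed (use assms in simp)

text \<open>
  Invariance under \<open>proj i\<close> is created when \<open>gamma i\<close> is applied and survives all other steps.
\<close>

lemma foldr_gamma_proj:
  fixes D :: "('f, 'i::{finite,linorder}) grassmann set"
  assumes "gr_subspace D" "i \<in> set xs" "x \<in> foldr gamma xs D"
  shows "proj i x \<in> foldr gamma xs D"
  using assms(2,3)
proof (induction xs arbitrary: x)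
  case (Cons j js)
  show ?case
  proof (cases "i = j")
    case True
    then show ?thesis
      using Cons.prems gamma_proj_self[OF foldr_gamma_subspace[OF assms(1)]] by simp
  next
    case False
    then show ?thesis
      using Cons gamma_proj_other[of "foldr gamma js D" i x j] by simp
  qed
qed simp

section \<open>Subspaces invariant under all projections\<close>

text \<open>
  The component along \<open>vmon J\<close> is isolated by applying \<open>proj i\<close> for \<open>i \<notin> J\<close> and \<open>1 - proj i\<close> for
  \<open>i \<in> J\<close>, one index at a time.
\<close>

lemma vmon_component_mem:
  fixes A :: "('f, 'i::{finite,linorder}) grassmann set"
  assumes A: "gr_subspace A" and inv: "\<And>i x. x \<in> A \<Longrightarrow> proj i x \<in> A" and x: "x \<in> A"
  shows "gscale (gcoeff x J) (vmon J) \<in> A"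
proof -
  \<comment> \<open>After the indices in \<open>S\<close> have been treated, exactly the coordinates at sets that agree with
    \<open>J\<close> on \<open>S\<close> survive.\<close>
  have "\<exists>y\<in>A. \<forall>K. gcoeff y K = (if K \<inter> S = J \<inter> S then gcoeff x K else 0)"
    if "finite S" for S
    using that
  proof (induction S rule: finite_induct)
    case empty
    then show ?case
      using x by auto
  next
    case (insert i S)
    then obtain y where y: "y \<in> A" "\<And>K. gcoeff y K = (if K \<inter> S = J \<inter> S then gcoeff x K else 0)"
      by blast
    define z where "z = (if i \<in> J then y - proj i y else proj i y)"
    have "z \<in> A"
      using y(1) inv A by (auto simp: z_def gr.subspace_diff)
    moreover have "gcoeff z K = (if K \<inter> insert i S = J \<inter> insert i S then gcoeff x K else 0)" for K
    proof -
      have "K \<inter> insert i S = J \<inter> insert i S \<longleftrightarrow> K \<inter> S = J \<inter> S \<and> (i \<in> K \<longleftrightarrow> i \<in> J)"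
        using insert.hyps by auto
      then show ?thesis
        by (auto simp: z_def y(2))
    qed
    ultimately show ?case
      by blast
  qed
  from this[of UNIV] obtain y where
    y: "y \<in> A" "\<And>K. gcoeff y K = (if K = J then gcoeff x K else 0)"
    by auto
  have "y = gscale (gcoeff x J) (vmon J)"
    by (rule gcoeff_eqI) (simp add: y(2))
  with y(1) show ?thesis
    by simp
qed

lemma span_vmon_if_proj_invariant:
  fixes A :: "('f, 'i::{finite,linorder}) grassmann set"
  assumes A: "gr_subspace A" and inv: "\<And>i x. x \<in> A \<Longrightarrow> proj i x \<in> A"
  shows "A = gr_span (vmon ` {J. vmon J \<in> A})"
proof
  show "gr_span (vmon ` {J. vmon J \<in> A}) \<subseteq> A"
    using A by (intro gr.span_minimal) auto
  show "A \<subseteq> gr_span (vmon ` {J. vmon J \<in> A})"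
  proof
    fix x
    assume x: "x \<in> A"
    have "gscale (gcoeff x J) (vmon J) \<in> gr_span (vmon ` {J. vmon J \<in> A})" for J
    proof (cases "gcoeff x J = 0")
      case False
      have "gscale (gcoeff x J) (vmon J) \<in> A"
        using vmon_component_mem[OF A inv x] .
      then have "gscale (inverse (gcoeff x J)) (gscale (gcoeff x J) (vmon J)) \<in> A"
        by (rule gr.subspace_scale[OF A])
      with False have "vmon J \<in> A"
        by simp
      then show ?thesis
        by (intro gr.span_scale gr.span_base) simp
    qed (simp add: gr.span_zero)
    then have "(\<Sum>J\<in>UNIV. gscale (gcoeff x J) (vmon J)) \<in> gr_span (vmon ` {J. vmon J \<in> A})"
      by (intro gr.span_sum)
    then show "x \<in> gr_span (vmon ` {J. vmon J \<in> A})"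
      using vmon_expansion[of x] by simp
  qed
qed

end

theorem theorem4p3:
  fixes D A :: "('f::field, 'i::{finite,linorder}) grassmann set"
  assumes "CHAR('f) \<noteq> 2"
    and "nonunital_subalgebra D"
    and "A = gamma_all D"
  shows "nonunital_subalgebra A \<and>
    (\<exists>\<J>. A = gr_span (vmon ` \<J>)) \<and>
    gr_dim A = gr_dim D \<and>
    (commutative_on D \<longrightarrow> commutative_on A) \<and>
    (square_space D = {0} \<longrightarrow> square_space A = {0})"
proof -
  have A: "A = foldr gamma (sorted_list_of_set UNIV) D"
    using assms(3) by (simp add: gamma_all_def)
  have D: "gr_subspace D"
    using assms(2) by (simp add: nonunital_subalgebra_def)
  have "nonunital_subalgebra A"
    unfolding A by (rule foldr_gamma_subalgebra[OF assms(1,2)])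
  moreover have "A = gr_span (vmon ` {J. vmon J \<in> A})"
  proof (rule span_vmon_if_proj_invariant[OF assms(1)])
    show "gr_subspace A"
      unfolding A by (rule foldr_gamma_subspace[OF assms(1) D])
    show "proj i x \<in> A" if "x \<in> A" for i x
      using that unfolding A by (intro foldr_gamma_proj[OF assms(1) D]) simp_all
  qed
  moreover have "gr_dim A = gr_dim D"
    unfolding A by (rule foldr_gamma_dim[OF assms(1) D])
  moreover have "commutative_on A" if "commutative_on D"
    unfolding A by (rule foldr_gamma_commutative[OF assms(1) that])
  moreover have "square_space A = {0}" if "square_space D = {0}"
    using that foldr_gamma_square_zero[OF assms(1), of D]
    unfolding A square_space_eq_0_iff by blast
  ultimately show ?thesis
    by blast
qed

end
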